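(* Let $m\ge 2$. Then, as formal power series in $q,z_1,\ldots,z_m$, $$\sum_{\mu\in\mathcal{D}_m} z_1^{s_1(\mu)}\cdots z_{m-1}^{s_{m-1}(\mu)}z_m^{s_m(\mu)}q^{|\mu|}=\sum_{\lambda\in\mathcal{O}_m} z_1^{\ell_1(\lambda)}\cdots z_{m-1}^{\ell_{m-1}(\lambda)}z_m^{\lfloor \lambda_1/m\rfloor-\mathrm{asc}(\lambda)}q^{|\lambda|}.$$
   Context: A partition $\lambda=(\lambda_1,\lambda_2,\ldots)$ is a nonincreasing sequence of nonnegative integers with finitely many nonzero terms (zeros appended as needed); $|\lambda|=\sum_i\lambda_i$. For $1\le i\le m$, $s_i(\lambda)=\lambda_i-\lambda_{i+1}+\lambda_{m+i}-\lambda_{m+i+1}+\lambda_{2m+i}-\lambda_{2m+i+1}+\cdots$, and $\ell_i(\lambda)=\#\{j:\lambda_j>0,\ \lambda_j\equiv i\pmod m\}$. $\mathcal{D}_m$ is the set of partitions in which each nonzero part appears at most $m-1$ times; $\mathcal{O}_m$ is the set of partitions none of whose nonzero parts is divisible by $m$. For $\lambda$ with nonzero parts $\lambda_1\ge\cdots\ge\lambda_r$, let $v_i$ be the least nonnegative residue of $\lambda_i$ modulo $m$; then $\mathrm{asc}(\lambda)=\#\{i:1\le i<r,\ v_i<v_{i+1}\}$. *)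

theory Defs
  imports
    "HOL-Analysis.Analysis"
    "HOL-Computational_Algebra.Formal_Power_Series"
    "HOL-Number_Theory.Cong"
    "HOL-Library.Poly_Mapping"
begin

text \<open>
  A partition is a nonincreasing sequence of naturals with finite support. The
  sequence itself is indexed from 0; \<open>nth_part p i\<close> is the i-th part with the
  customary indexing from 1 and is meant for \<open>i \<ge> 1\<close> only.
\<close>

definition is_partition :: "(nat \<Rightarrow> nat) \<Rightarrow> bool" where
  "is_partition p \<longleftrightarrow> antimono p \<and> finite {i. p i \<noteq> 0}"

definition nth_part :: "(nat \<Rightarrow> nat) \<Rightarrow> nat \<Rightarrow> nat" where
  "nth_part p i = p (i - 1)"

definition psize :: "(nat \<Rightarrow> nat) \<Rightarrow> nat" where
  "psize p = Sum_any p"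

definition num_parts :: "(nat \<Rightarrow> nat) \<Rightarrow> nat" where
  "num_parts p = card {i. 1 \<le> i \<and> nth_part p i > 0}"

text \<open>
  The subtraction never truncates on a partition, and for \<open>m \<ge> 1\<close> only finitely
  many summands are nonzero.
\<close>

definition s_stat :: "nat \<Rightarrow> nat \<Rightarrow> (nat \<Rightarrow> nat) \<Rightarrow> nat" where
  "s_stat m i p = Sum_any (\<lambda>k. nth_part p (k * m + i) - nth_part p (k * m + i + 1))"

definition l_stat :: "nat \<Rightarrow> nat \<Rightarrow> (nat \<Rightarrow> nat) \<Rightarrow> nat" where
  "l_stat m i p = card {j. 1 \<le> j \<and> nth_part p j > 0 \<and> [nth_part p j = i] (mod m)}"

definition D_parts :: "nat \<Rightarrow> (nat \<Rightarrow> nat) set" where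
  "D_parts m = {p. is_partition p \<and>
     (\<forall>k>0. card {j. 1 \<le> j \<and> nth_part p j = k} \<le> m - 1)}"

definition O_parts :: "nat \<Rightarrow> (nat \<Rightarrow> nat) set" where
  "O_parts m = {p. is_partition p \<and> (\<forall>j\<ge>1. nth_part p j > 0 \<longrightarrow> \<not> m dvd nth_part p j)}"

definition asc :: "nat \<Rightarrow> (nat \<Rightarrow> nat) \<Rightarrow> nat" where
  "asc m p = card {i. 1 \<le> i \<and> i < num_parts p \<and> nth_part p i mod m < nth_part p (i + 1) mod m}"

text \<open>
  Justifies writing \<open>\<lfloor>\<lambda>\<^sub>1/m\<rfloor> - asc(\<lambda>)\<close> with subtraction on the naturals.
\<close>

lemma asc_le:
  assumes "is_partition p"
  shows "asc m p \<le> nth_part p 1 div m"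
proof -
  have anti: "p (Suc i) \<le> p i" for i
    using assms by (simp add: is_partition_def antimono_def)
  have step: "p (Suc i) div m + (if p i mod m < p (Suc i) mod m then 1 else 0) \<le> p i div m" for i
  proof (cases "p i mod m < p (Suc i) mod m")
    case True
    have "p (Suc i) div m \<noteq> p i div m"
    proof
      assume eq: "p (Suc i) div m = p i div m"
      have "p i < p (Suc i)"
        using True div_mult_mod_eq[of "p i" m] div_mult_mod_eq[of "p (Suc i)" m]
        unfolding eq by linarith
      then show False using anti[of i] by simp
    qed
    moreover have "p (Suc i) div m \<le> p i div m"
      using anti by (rule div_le_mono)
    ultimately show ?thesis using True by simp
  next
    case False
    then show ?thesis using anti[of i] by (simp add: div_le_mono)
  qed
  have main: "card {i. i < n \<and> p i mod m < p (Suc i) mod m} + p n div m \<le> p 0 div m" for n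
  proof (induction n)
    case (Suc n)
    have "{i. i < Suc n \<and> p i mod m < p (Suc i) mod m} =
      {i. i < n \<and> p i mod m < p (Suc i) mod m} \<union>
      (if p n mod m < p (Suc n) mod m then {n} else {})"
      by (auto simp: less_Suc_eq)
    then have "card {i. i < Suc n \<and> p i mod m < p (Suc i) mod m} =
      card {i. i < n \<and> p i mod m < p (Suc i) mod m} +
      (if p n mod m < p (Suc n) mod m then 1 else 0)"
      by simp
    then show ?case using Suc.IH step[of n] by linarith
  qed simp
  have "{i. 1 \<le> i \<and> i < num_parts p \<and> nth_part p i mod m < nth_part p (i + 1) mod m}
    \<subseteq> Suc ` {i. i < num_parts p \<and> p i mod m < p (Suc i) mod m}"
  proof
    fix i assume i: "i \<in> {i. 1 \<le> i \<and> i < num_parts p \<and> nth_part p i mod m < nth_part p (i + 1) mod m}"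
    then obtain j where "i = Suc j" by (cases i) auto
    then show "i \<in> Suc ` {i. i < num_parts p \<and> p i mod m < p (Suc i) mod m}"
      using i by (auto simp: nth_part_def)
  qed
  then have "asc m p \<le> card (Suc ` {i. i < num_parts p \<and> p i mod m < p (Suc i) mod m})"
    unfolding asc_def by (intro card_mono) auto
  also have "\<dots> = card {i. i < num_parts p \<and> p i mod m < p (Suc i) mod m}"
    by (simp add: card_image)
  also have "\<dots> \<le> nth_part p 1 div m"
    using main[of "num_parts p"] by (simp add: nth_part_def)
  finally show ?thesis .
qed

text \<open>
  The power series live in \<open>\<int>[z\<^sub>1, z\<^sub>2, \<dots>][[q]]\<close>, a subring of
  \<open>\<int>[[q, z\<^sub>1, z\<^sub>2, \<dots>]]\<close>: monomials in the \<open>z\<^sub>i\<close> are finitely supported exponent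
  functions, polynomials are finitely supported functions from monomials to
  integers, and \<open>q\<close> is \<open>fps_X\<close>. The ring carries the q-adic topology (the library
  metric on formal power series), so an infinite sum converges iff for each n all but
  finitely many summands vanish modulo \<open>q\<^sup>n\<close>.
\<close>

type_synonym qz_series = "((nat \<Rightarrow>\<^sub>0 nat) \<Rightarrow>\<^sub>0 int) fps"

definition zvar :: "nat \<Rightarrow> qz_series" where
  "zvar i = fps_const (Poly_Mapping.single (Poly_Mapping.single i 1) 1)"

definition qvar :: qz_series where
  "qvar = fps_X"

end

theory Submission
  imports Defs
begin

text \<open>
  Conjugation turns \<open>\<D>\<^sub>m\<close> into the partitions whose consecutive differences, including the
  last part, are less than \<open>m\<close>. Such a partition is determined by its word \<open>w\<close> of residues,
  an arbitrary word over \<open>{0, \<dots>, m - 1}\<close> with nonzero last letter, and its size is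
  \<open>\<Sum>w + m maj w\<close>, where \<open>maj\<close> adds the positions of the ascents; \<open>s\<^sub>i\<close> counts the letters \<open>i\<close>
  and \<open>s\<^sub>m\<close> the letters \<open>0\<close>. On the other side, \<open>\<lambda> \<in> \<O>\<^sub>m\<close> is given by its residue word \<open>v\<close>, of
  length \<open>r\<close> and without zeros, together with a partition \<open>b\<close> into at most \<open>r\<close> parts: \<open>m b\<close> is the
  excess of \<open>\<lambda>\<close> over the smallest partition with residue word \<open>v\<close>. Then
  \<open>|\<lambda>| = \<Sum>v + m (maj v + |b|)\<close> and \<open>b\<^sub>1 = \<lfloor>\<lambda>\<^sub>1/m\<rfloor> - asc \<lambda>\<close>. It remains to match, for fixed \<open>v\<close>, the
  ways of inserting \<open>c\<close> zeros into \<open>v\<close> (none at the end) with the partitions \<open>b\<close> such that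
  \<open>b\<^sub>1 = c\<close>, so that \<open>maj w - maj v = |b|\<close>. Both are encoded by the numbers of zeros
  inserted directly before each letter of \<open>v\<close>.
\<close>

section \<open>Inserting zeros into a word\<close>

text \<open>
  All words, and all partitions given as lists, are reversed: the head belongs to the smallest
  part, so an ascent at position \<open>j\<close> shows up as a descent followed by exactly \<open>j\<close> letters.
\<close>

abbreviation rises :: "nat \<Rightarrow> nat list \<Rightarrow> bool" where
  "rises x w \<equiv> w \<noteq> [] \<and> hd w < x"

primrec maj :: "nat list \<Rightarrow> nat" where
  "maj [] = 0"
| "maj (x # w) = (if rises x w then length w else 0) + maj w"

primrec num_rises :: "nat list \<Rightarrow> nat" where
  "num_rises [] = 0"
| "num_rises (x # w) = (if rises x w then 1 else 0) + num_rises w"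

primrec stair :: "nat \<Rightarrow> nat list \<Rightarrow> nat list" where
  "stair m [] = []"
| "stair m (x # w) = x # map (\<lambda>a. a + (if rises x w then m else 0)) (stair m w)"

primrec insert_zeros :: "nat list \<Rightarrow> nat list \<Rightarrow> nat list" where
  "insert_zeros [] ks = []"
| "insert_zeros (x # v) ks = x # replicate (hd ks) 0 @ insert_zeros v (tl ks)"

text \<open>
  If \<open>k\<close> zeros precede the last letter \<open>x\<close> of a word with \<open>r\<close> nonzero letters and \<open>c\<close> zeros, they
  create an ascent at position \<open>r + c - 1\<close> when \<open>k > 0\<close>. When \<open>k = 0\<close>, there is an ascent at
  that place iff \<open>x\<close> already closes an ascent of \<open>v\<close>, where it has position \<open>r - 1\<close>. The three cases
  realise the resulting increment of \<open>maj w - maj v\<close>, namely \<open>c\<close>, \<open>0\<close> and \<open>r + c - 1\<close>,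
  keeping \<open>c\<close> as the largest part.
\<close>

primrec levels :: "nat list \<Rightarrow> nat list \<Rightarrow> nat list" where
  "levels [] ks = []"
| "levels (x # v) ks =
    (if rises x v then levels v (tl ks) @ [sum_list ks]
     else if hd ks = 0 then 0 # levels v (tl ks)
     else map Suc (levels v (tl ks)) @ [sum_list ks])"

section \<open>The smallest partition with a given residue word\<close>

lemma length_stair [simp]: "length (stair m w) = length w"
  by (induction w) auto

lemma stair_eq_Nil_iff [simp]: "stair m w = [] \<longleftrightarrow> w = []"
  by (cases w) auto

lemma hd_stair [simp]: "w \<noteq> [] \<Longrightarrow> hd (stair m w) = hd w"
  by (cases w) auto

lemma sum_list_map_add: "sum_list (map (\<lambda>a. a + c) xs) = sum_list xs + c * length xs"
  for c :: nat
  by (induction xs) auto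

text \<open>Each ascent adds \<open>m\<close> to every entry above it, and the number of these
  entries is its position.\<close>

lemma sum_list_stair: "sum_list (stair m w) = sum_list w + m * maj w"
  by (induction w) (auto simp: sum_list_map_add algebra_simps)

lemma map_mod_stair: "set w \<subseteq> {..<m} \<Longrightarrow> map (\<lambda>a. a mod m) (stair m w) = w"
  by (induction w) (auto simp: o_def)

text \<open>Without an ascent the next residue is at least the head; with one, the added
  \<open>m\<close> exceeds the head. This gives sortedness and, for a nonzero head, the absence of
  zero parts.\<close>

lemma stair_ge_hd:
  assumes "set w \<subseteq> {..<m}" "a \<in> set (stair m w)"
  shows "hd w \<le> a"
  using assms
proof (induction w arbitrary: a)
  case (Cons x w)
  show ?case
  proof (cases "a = x")
    case False
    then obtain b where b: "b \<in> set (stair m w)" "a = b + (if rises x w then m else 0)"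
      using Cons.prems by auto
    then have "hd w \<le> b" "w \<noteq> []" using Cons by auto
    then show ?thesis using b Cons.prems by (auto split: if_splits)
  qed simp
qed simp

lemma sorted_map_add: "sorted xs \<Longrightarrow> sorted (map (\<lambda>a. a + c) xs)" for c :: nat
  by (simp add: sorted_wrt_map)

lemma sorted_stair:
  assumes "set w \<subseteq> {..<m}"
  shows "sorted (stair m w)"
  using assms
proof (induction w)
  case (Cons x w)
  have "x \<le> b + (if rises x w then m else 0)" if "b \<in> set (stair m w)" for b
    using stair_ge_hd[of w m b] that Cons.prems by (cases w) auto
  then show ?case using Cons by (auto intro: sorted_map_add)
qed simp

text \<open>The largest part receives the shift \<open>m\<close> of every ascent, and its residue
  does not affect the quotient.\<close>

lemma last_stair_div:
  assumes "set w \<subseteq> {..<m}" "w \<noteq> []"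
  shows "last (stair m w) div m = num_rises w"
  using assms
proof (induction w)
  case (Cons x w)
  then show ?case by (cases "w = []") (auto simp: last_map)
qed simp

section \<open>The effect of inserted zeros on the major index\<close>

lemma length_insert_zeros:
  "length ks = length v \<Longrightarrow> length (insert_zeros v ks) = length v + sum_list ks"
proof (induction v arbitrary: ks)
  case (Cons x v)
  then show ?case by (cases ks) auto
qed simp

lemma insert_zeros_eq_Nil_iff [simp]: "insert_zeros v ks = [] \<longleftrightarrow> v = []"
  by (cases v) auto

lemma hd_insert_zeros [simp]: "v \<noteq> [] \<Longrightarrow> hd (insert_zeros v ks) = hd v"
  by (cases v) auto

lemma length_levels [simp]: "length (levels v ks) = length v"
  by (induction v arbitrary: ks) auto

lemma sum_list_map_Suc: "sum_list (map Suc xs) = sum_list xs + length xs"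
  by (induction xs) auto

text \<open>An ascent ends at a letter larger than its predecessor, which a zero never is.\<close>

lemma maj_replicate_zero: "maj (replicate k 0 @ w) = maj w"
  by (induction k) (auto simp: hd_append)

lemma maj_insert_zeros:
  assumes "length ks = length v" "0 \<notin> set v"
  shows "maj (insert_zeros v ks) = maj v + sum_list (levels v ks)"
  using assms
proof (induction v arbitrary: ks)
  case (Cons x v)
  then obtain k ks' where ks: "ks = k # ks'" "length ks' = length v" by (cases ks) auto
  have IH: "maj (insert_zeros v ks') = maj v + sum_list (levels v ks')"
    using Cons ks by simp
  show ?case
  proof (cases "k = 0")
    case True
    then show ?thesis using IH ks by (auto simp: length_insert_zeros)
  next
    case False
    \<comment> \<open>A zero now stands directly before the nonzero letter \<open>x\<close>, so
      \<open>x\<close> closes an ascent whether or not it did so in \<open>v\<close>.\<close>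
    then have "rises x (replicate k 0 @ insert_zeros v ks')"
      using Cons.prems by (auto simp: hd_append)
    then show ?thesis using IH ks False Cons.prems
      by (auto simp: length_insert_zeros maj_replicate_zero sum_list_map_Suc)
  qed
qed simp

text \<open>The entries grow by \<open>Suc\<close> only when at least one zero is inserted, so the
  total grows by as much. Hence appending \<open>sum_list ks\<close> keeps the list sorted.\<close>

lemma levels_le: "length ks = length v \<Longrightarrow> a \<in> set (levels v ks) \<Longrightarrow> a \<le> sum_list ks"
proof (induction v arbitrary: ks a)
  case (Cons x v)
  then obtain k ks' where ks: "ks = k # ks'" "length ks' = length v" by (cases ks) auto
  show ?case using Cons.prems Cons.IH[of ks'] ks
    by (fastforce split: if_splits)
qed simp

lemma last_levels: "length ks = length v \<Longrightarrow> v \<noteq> [] \<Longrightarrow> last (levels v ks) = sum_list ks"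
proof (induction v arbitrary: ks)
  case (Cons x v)
  then obtain k ks' where ks: "ks = k # ks'" "length ks' = length v" by (cases ks) auto
  show ?case
  proof (cases "v = []")
    case True
    then show ?thesis using ks by simp
  next
    case False
    then have "levels v ks' \<noteq> []" by (metis length_levels length_0_conv)
    then show ?thesis using Cons.IH[of ks'] False ks by simp
  qed
qed simp

lemma sorted_levels: "length ks = length v \<Longrightarrow> sorted (levels v ks)"
proof (induction v arbitrary: ks)
  case (Cons x v)
  then obtain k ks' where ks: "ks = k # ks'" "length ks' = length v" by (cases ks) auto
  show ?case using Cons.IH[of ks'] levels_le[of ks' v] ks
    by (fastforce simp: sorted_append sorted_wrt_map)
qed simp

text \<open>For an \<open>x\<close> that does not rise, the head is 0 exactly when no zero is
  inserted at \<open>x\<close>, so the cases of \<open>levels\<close> can be told apart. Where a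
  last entry was appended, it gives the total and hence \<open>k\<close>.\<close>

lemma levels_inj:
  assumes "length ks = length v" "length ls = length v" "levels v ks = levels v ls"
  shows "ks = ls"
  using assms
proof (induction v arbitrary: ks ls)
  case (Cons x v)
  obtain k ks' where ks: "ks = k # ks'" "length ks' = length v" using Cons.prems by (cases ks) auto
  obtain l ls' where ls: "ls = l # ls'" "length ls' = length v" using Cons.prems by (cases ls) auto
  have "levels v ks' = levels v ls' \<and> (k = 0 \<longleftrightarrow> l = 0) \<and> (k \<noteq> 0 \<or> l \<noteq> 0 \<longrightarrow> k + sum_list ks' = l + sum_list ls')
     \<or> rises x v \<and> levels v ks' = levels v ls' \<and> k + sum_list ks' = l + sum_list ls'"
  proof (cases "rises x v \<or> (k = 0 \<longleftrightarrow> l = 0)")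
    case True
    then show ?thesis using Cons.prems(3) ks ls
      by (auto split: if_splits)
  next
    case False
    then have "hd (levels (x # v) ks) = 0 \<longleftrightarrow> hd (levels (x # v) ls) \<noteq> 0"
      using ks ls by (cases "levels v ks'"; cases "levels v ls'") auto
    then show ?thesis using Cons.prems(3) by auto
  qed
  then show ?case using Cons.IH[of ks' ls'] ks ls by auto
qed simp

text \<open>Decoding strips the last entry or a zero head and decodes the rest first. The last entry
  minus the zeros used there is the number left for \<open>x\<close>.\<close>

lemma levels_surj:
  assumes "sorted b" "length b = length v"
  shows "\<exists>ks. length ks = length v \<and> levels v ks = b"
  using assms
proof (induction v arbitrary: b)
  case (Cons x v)
  then have ne: "b \<noteq> []" by auto
  \<comment> \<open>The tail uses at most \<open>last b - d\<close> zeros, so at least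
    \<open>d\<close> remain for \<open>x\<close> if \<open>d \<le> last b\<close>. A rising
    \<open>x\<close> needs only \<open>d = 0\<close>; otherwise \<open>d = 1\<close> makes the
    insertion nonempty.\<close>
  have top: "\<exists>ks. length ks = length v \<and> levels v ks = c \<and> sum_list ks \<le> last b - d"
    if "sorted c" "length c = length v" "\<forall>a\<in>set c. a \<le> last b - d" for c d
  proof -
    obtain ks where ks: "length ks = length v" "levels v ks = c"
      using Cons.IH[of c] \<open>sorted c\<close> \<open>length c = length v\<close> by blast
    show ?thesis
    proof (cases "v = []")
      case False
      then have "sum_list ks = last c" "c \<noteq> []" using last_levels[OF ks(1)] ks that by auto
      then show ?thesis using ks that by auto
    qed (use ks in auto)
  qed
  show ?case
  proof (cases "rises x v")
    case True
    have "sorted (butlast b)" "length (butlast b) = length v" "\<forall>a\<in>set (butlast b). a \<le> last b - 0"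
      using Cons.prems sorted_append[of "butlast b" "[last b]"] append_butlast_last_id[OF ne] by auto
    then obtain ks where ks: "length ks = length v" "levels v ks = butlast b" "sum_list ks \<le> last b"
      using top[of "butlast b" 0] by auto
    then have "levels (x # v) ((last b - sum_list ks) # ks) = b"
      using True ne by simp
    then show ?thesis using ks by (intro exI[of _ "(last b - sum_list ks) # ks"]) simp
  next
    case False
    show ?thesis
    proof (cases "hd b = 0")
      case True
      obtain ks where "length ks = length v" "levels v ks = tl b"
        using Cons.IH[of "tl b"] Cons.prems by (auto simp: sorted_tl)
      moreover have "b = 0 # tl b" using True ne by (metis list.collapse)
      ultimately show ?thesis using False by (intro exI[of _ "0 # ks"]) auto
    next
      case hd: False
      then have pos: "a > 0" if "a \<in> set b" for a
        using that Cons.prems(1) ne by (cases b) auto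
      \<comment> \<open>Undoes \<open>map Suc\<close>, without truncation since the sorted list
        \<open>b\<close> has a positive head.\<close>
      define c where "c = map (\<lambda>a. a - 1) (butlast b)"
      have c: "map Suc c = butlast b"
        using pos in_set_butlastD[of _ b] unfolding c_def by (auto simp: o_def intro!: map_idI)
      have sb: "sorted (butlast b)" "length (butlast b) = length v" "\<forall>a\<in>set (butlast b). a \<le> last b"
        using Cons.prems sorted_append[of "butlast b" "[last b]"] append_butlast_last_id[OF ne] by auto
      then have "sorted c" "length c = length v" "\<forall>a\<in>set c. a \<le> last b - 1"
        unfolding c_def by (auto simp: sorted_wrt_map intro: sorted_wrt_mono_rel[of _ "(\<le>)"] diff_le_mono)
      then obtain ks where ks: "length ks = length v" "levels v ks = c" "sum_list ks \<le> last b - 1"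
        using top[of c 1] by auto
      have "last b > 0" using pos ne by simp
      then have "levels (x # v) ((last b - sum_list ks) # ks) = b"
        using False ne ks c by auto
      then show ?thesis using ks by (intro exI[of _ "(last b - sum_list ks) # ks"]) simp
    qed
  qed
qed simp

section \<open>Unique decomposition of a word into nonzero letters and runs of zeros\<close>

lemma insert_zeros_inj:
  assumes "length ks = length v" "length ls = length u" "0 \<notin> set u" "0 \<notin> set v"
    "insert_zeros v ks = insert_zeros u ls"
  shows "v = u \<and> ks = ls"
  using assms
proof (induction v arbitrary: ks ls u)
  case Nil
  then show ?case by (cases u) auto
next
  case (Cons x v)
  obtain k ks' where ks: "ks = k # ks'" "length ks' = length v" using Cons.prems by (cases ks) auto
  obtain u' where u: "u = x # u'" using Cons.prems by (cases u) auto
  obtain l ls' where ls: "ls = l # ls'" "length ls' = length u'" using Cons.prems u by (cases ls) auto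
  have eq: "replicate k 0 @ insert_zeros v ks' = replicate l 0 @ insert_zeros u' ls'"
    using Cons.prems(5) ks ls u by simp
  \<comment> \<open>The letter after an inserted run is nonzero, so the maximal initial run of zeros
    is exactly the inserted one.\<close>
  have tw: "takeWhile (\<lambda>a. a = 0) (replicate n 0 @ insert_zeros t js) = replicate n 0"
    "dropWhile (\<lambda>a. a = 0) (replicate n 0 @ insert_zeros t js) = insert_zeros t js"
    if "0 \<notin> set t" for n t js using that
    by (cases t; auto simp: takeWhile_append dropWhile_append)+
  have "replicate k (0::nat) = replicate l 0" "insert_zeros v ks' = insert_zeros u' ls'"
    using tw[of v k ks'] tw[of u' l ls'] eq Cons.prems u by auto
  then show ?case using Cons.IH[of ks' ls' u'] Cons.prems ks ls u
    by (metis length_replicate list.set_intros(2))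
qed

lemma insert_zeros_surj:
  assumes "w = [] \<or> hd w \<noteq> 0"
  shows "\<exists>v ks. length ks = length v \<and> set v = set w - {0} \<and> insert_zeros v ks = w"
  using assms
\<comment> \<open>Each step removes a letter together with a whole run of zeros, hence induction on
  the length.\<close>
proof (induction w rule: length_induct)
  case (1 w)
  show ?case
  proof (cases w)
    case (Cons x t)
    define t' where "t' = dropWhile (\<lambda>a. a = 0) t"
    define k where "k = length (takeWhile (\<lambda>a. a = 0) t)"
    have "takeWhile (\<lambda>a. a = 0) t = replicate k 0"
      by (rule replicate_eqI) (auto simp: k_def dest: set_takeWhileD)
    then have t: "t = replicate k 0 @ t'"
      unfolding t'_def using takeWhile_dropWhile_id[of "\<lambda>a. a = 0" t] by simp
    have "t' = [] \<or> hd t' \<noteq> 0" unfolding t'_def using hd_dropWhile[of "\<lambda>a. a = 0" t] by blast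
    moreover have "length t' < length w" using Cons t by simp
    ultimately obtain v ks where v: "length ks = length v" "set v = set t' - {0}"
        "insert_zeros v ks = t'"
      using 1(1) by blast
    have "x \<noteq> 0" using 1(2) Cons by simp
    then have "set w - {0} = insert x (set t' - {0})"
      unfolding Cons t by (auto simp: insert_Diff_if)
    then have "set (x # v) = set w - {0}" using v by simp
    moreover have "insert_zeros (x # v) (k # ks) = w" using v Cons t by simp
    moreover have "length (k # ks) = length (x # v)" using v by simp
    ultimately show ?thesis by blast
  qed simp
qed

text \<open>The common index set of the two bijections compared at the end.\<close>

definition codes :: "nat \<Rightarrow> (nat list \<times> nat list) set" where
  "codes m = {(v, ks). length ks = length v \<and> set v \<subseteq> {1..<m}}"

lemma bij_betw_insert_zeros:
  "bij_betw (\<lambda>(v, ks). insert_zeros v ks) (codes m) {w. set w \<subseteq> {..<m} \<and> (w = [] \<or> hd w \<noteq> 0)}"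
  unfolding bij_betw_def
proof
  have no0: "0 \<notin> set v" if "set v \<subseteq> {1..<m}" for v using that by auto
  show "inj_on (\<lambda>(v, ks). insert_zeros v ks) (codes m)"
  proof (rule inj_onI, clarify, goal_cases)
    case (1 v ks u ls)
    then show ?case using insert_zeros_inj[of ks v ls u] no0 by (simp add: codes_def)
  qed
  define S where "S = {w. set w \<subseteq> {..<m} \<and> (w = [] \<or> hd w \<noteq> 0)}"
  have "set (insert_zeros v ks) \<subseteq> insert 0 (set v)" for v ks
    by (induction v arbitrary: ks) auto
  then have "insert_zeros v ks \<in> S" if "(v, ks) \<in> codes m" for v ks
  proof (cases v)
    case (Cons x u)
    have "insert 0 (set v) \<subseteq> {..<m}" "hd v \<noteq> 0" using that Cons by (auto simp: codes_def)
    then show ?thesis using \<open>set (insert_zeros v ks) \<subseteq> insert 0 (set v)\<close> Cons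
      unfolding S_def by (auto simp del: insert_zeros.simps)
  qed (simp add: S_def)
  moreover have "w \<in> (\<lambda>(v, ks). insert_zeros v ks) ` codes m" if "w \<in> S" for w
  proof -
    have w: "set w \<subseteq> {..<m}" "w = [] \<or> hd w \<noteq> 0" using that by (auto simp: S_def)
    obtain v ks where v: "length ks = length v" "set v = set w - {0}" "insert_zeros v ks = w"
      using insert_zeros_surj[OF w(2)] by blast
    then have "set v \<subseteq> {1..<m}" using w by auto
    then have "(v, ks) \<in> codes m" using v by (simp add: codes_def)
    then show ?thesis using v(3) by (intro image_eqI[of _ _ "(v, ks)"]) simp_all
  qed
  ultimately have "(\<lambda>(v, ks). insert_zeros v ks) ` codes m = S" by auto
  then show "(\<lambda>(v, ks). insert_zeros v ks) ` codes m
      = {w. set w \<subseteq> {..<m} \<and> (w = [] \<or> hd w \<noteq> 0)}"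
    by (simp only: S_def)
qed

section \<open>Residue words of partitions\<close>

text \<open>The parameter \<open>p\<close> carries the preceding entry; starting from
  \<open>p = 0\<close> applies the bound to the smallest part as well.\<close>

primrec flat :: "nat \<Rightarrow> nat \<Rightarrow> nat list \<Rightarrow> bool" where
  "flat m p [] \<longleftrightarrow> True"
| "flat m p (a # L) \<longleftrightarrow> p \<le> a \<and> a < p + m \<and> flat m a L"

lemma flat_sorted: "flat m p L \<Longrightarrow> sorted (p # L)"
proof (induction L arbitrary: p)
  case (Cons a L)
  then have "sorted (a # L)" "p \<le> a" by auto
  then show ?case by auto
qed simp

lemma flat_map_add: "flat m (p + c) (map (\<lambda>a. a + c) L) \<longleftrightarrow> flat m p L"
  by (induction L arbitrary: p) auto

lemma flat_stair:
  assumes "set w \<subseteq> {..<m}"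
  shows "flat m 0 (stair m w)"
  using assms
proof (induction w)
  case (Cons x w)
  show ?case
  proof (cases w)
    case (Cons y u)
    obtain T where T: "stair m w = y # T" using Cons by simp
    have "flat m y T" using Cons.IH Cons.prems T by simp
    then have "flat m (y + (if y < x then m else 0)) (map (\<lambda>a. a + (if y < x then m else 0)) T)"
      by (simp only: flat_map_add)
    then show ?thesis using Cons.prems T Cons by (auto split: if_splits)
  qed (use Cons.prems in auto)
qed simp

text \<open>The tail of a flat list need not start below \<open>m\<close>, so the induction carries
  a shift by the quotient of the head.\<close>

lemma stair_map_mod:
  assumes "flat m p L" "0 < m"
  shows "L = map (\<lambda>a. a + m * (hd L div m)) (stair m (map (\<lambda>a. a mod m) L))"
  using assms
proof (induction L arbitrary: p)
  case (Cons a L)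
  show ?case
  proof (cases L)
    case (Cons b L')
    have IH: "L = map (\<lambda>c. c + m * (b div m)) (stair m (map (\<lambda>a. a mod m) L))"
      using Cons.IH[of a] Cons.prems Cons by simp
    have ab: "a \<le> b" "b < a + m" using Cons.prems Cons by auto
    \<comment> \<open>Moving up by less than \<open>m\<close> raises the quotient by one exactly
      when the residue drops.\<close>
    have "b div m = a div m + (if b mod m < a mod m then 1 else 0)"
    proof -
      have "a div m \<le> b div m" "b div m \<le> a div m + 1"
        using ab \<open>0 < m\<close> div_le_mono[of a b m] div_le_mono[of b "a + m" m] by auto
      then consider "b div m = a div m" | "b div m = a div m + 1" by linarith
      then show ?thesis
      proof cases
        case 1
        then have "b = a div m * m + b mod m" using div_mult_mod_eq[of b m] by simp
        then have "\<not> b mod m < a mod m" using ab div_mult_mod_eq[of a m] by linarith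
        then show ?thesis using 1 by simp
      next
        case 2
        then have "b = a div m * m + m + b mod m" using div_mult_mod_eq[of b m] by simp
        then have "b mod m < a mod m" using ab div_mult_mod_eq[of a m] by linarith
        then show ?thesis using 2 by simp
      qed
    qed
    then have eq: "m * (b div m) = (if b mod m < a mod m then m else 0) + m * (a div m)" by simp
    have L: "L = map (\<lambda>c. c + (if b mod m < a mod m then m else 0) + m * (a div m))
      (stair m (map (\<lambda>a. a mod m) L))"
      by (rule IH[unfolded eq add.assoc[symmetric]])
    have st: "stair m (map (\<lambda>a. a mod m) (a # L)) =
      a mod m # map (\<lambda>c. c + (if b mod m < a mod m then m else 0)) (stair m (map (\<lambda>a. a mod m) L))"
      by (simp add: Cons)
    have "map (\<lambda>c. c + m * (a div m)) (stair m (map (\<lambda>a. a mod m) (a # L)))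
      = a # map (\<lambda>c. c + (if b mod m < a mod m then m else 0) + m * (a div m))
        (stair m (map (\<lambda>a. a mod m) L))"
      unfolding st by (simp add: o_def)
    then show ?thesis using arg_cong[OF L, of "(#) a"] by (simp only: list.sel)
  qed simp
qed simp

lemma bij_betw_stair:
  assumes "0 < m"
  shows "bij_betw (stair m) {w. set w \<subseteq> {..<m} \<and> (w = [] \<or> hd w \<noteq> 0)} {L. flat m 0 L \<and> 0 \<notin> set L}"
proof (rule bij_betwI[where g = "map (\<lambda>a. a mod m)"])
  show "stair m \<in> {w. set w \<subseteq> {..<m} \<and> (w = [] \<or> hd w \<noteq> 0)} \<rightarrow> {L. flat m 0 L \<and> 0 \<notin> set L}"
  proof (intro funcsetI CollectI conjI)
    fix w assume w: "w \<in> {w. set w \<subseteq> {..<m} \<and> (w = [] \<or> hd w \<noteq> 0)}"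
    then show "flat m 0 (stair m w)" by (intro flat_stair) simp
    show "0 \<notin> set (stair m w)"
    proof
      assume "0 \<in> set (stair m w)"
      moreover from this have "w \<noteq> []" by auto
      ultimately show False using w stair_ge_hd[of w m 0] by simp
    qed
  qed
  show "map (\<lambda>a. a mod m) \<in> {L. flat m 0 L \<and> 0 \<notin> set L} \<rightarrow> {w. set w \<subseteq> {..<m} \<and> (w = [] \<or> hd w \<noteq> 0)}"
  proof
    fix L assume "L \<in> {L. flat m 0 L \<and> 0 \<notin> set L}"
    then show "map (\<lambda>a. a mod m) L \<in> {w. set w \<subseteq> {..<m} \<and> (w = [] \<or> hd w \<noteq> 0)}"
      using assms by (cases L) auto
  qed
  show "map (\<lambda>a. a mod m) (stair m w) = w" if "w \<in> {w. set w \<subseteq> {..<m} \<and> (w = [] \<or> hd w \<noteq> 0)}" for w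
    using that map_mod_stair by blast
  show "stair m (map (\<lambda>a. a mod m) L) = L" if "L \<in> {L. flat m 0 L \<and> 0 \<notin> set L}" for L
  proof (cases L)
    case (Cons a L')
    \<comment> \<open>The head is below \<open>m\<close>, so the shift in
      \<open>stair_map_mod\<close> vanishes.\<close>
    then have "hd L div m = 0" using that by simp
    then show ?thesis using stair_map_mod[of m 0 L] that assms by simp
  qed simp
qed

section \<open>Partitions with a given residue word as lifts of the smallest one\<close>

definition lift_stair :: "nat \<Rightarrow> nat list \<Rightarrow> nat list \<Rightarrow> nat list" where
  "lift_stair m v b = map2 (\<lambda>a c. a + m * c) (stair m v) b"

lemma length_lift_stair [simp]: "length b = length v \<Longrightarrow> length (lift_stair m v b) = length v"
  by (simp add: lift_stair_def)

lemma map_mod_lift_stair: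
  assumes "set v \<subseteq> {..<m}" "length b = length v"
  shows "map (\<lambda>a. a mod m) (lift_stair m v b) = v"
proof -
  have "map (\<lambda>a. a mod m) (lift_stair m v b) = map (\<lambda>a. a mod m) (stair m v)"
    using assms(2) by (intro nth_equalityI) (auto simp: lift_stair_def)
  then show ?thesis using map_mod_stair[OF assms(1)] by simp
qed

lemma sorted_lift_stair:
  assumes "set v \<subseteq> {..<m}" "length b = length v" "sorted b"
  shows "sorted (lift_stair m v b)"
  using sorted_stair[OF assms(1)] assms(2,3)
  by (auto simp: sorted_iff_nth_mono lift_stair_def intro!: add_mono)

lemma sum_list_lift_stair:
  assumes "length b = length v"
  shows "sum_list (lift_stair m v b) = sum_list v + m * (maj v + sum_list b)"
proof -
  have "sum_list (map2 (\<lambda>a c. a + m * c) s b) = sum_list s + m * sum_list b"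
    if "length s = length b" for s
    using that by (induction s b rule: list_induct2) (auto simp: algebra_simps)
  then show ?thesis using assms by (simp add: lift_stair_def sum_list_stair algebra_simps)
qed

lemma lift_stair_inj:
  assumes "0 < m" "set v \<subseteq> {..<m}" "length b = length v" "set u \<subseteq> {..<m}" "length c = length u"
    "lift_stair m v b = lift_stair m u c"
  shows "v = u \<and> b = c"
proof
  show "v = u" using assms map_mod_lift_stair by metis
  have "b ! i = c ! i" if "i < length b" for i
    using arg_cong[OF assms(6), of "\<lambda>L. L ! i"] that assms(1,3,5) \<open>v = u\<close>
    by (simp add: lift_stair_def)
  then show "b = c" using assms \<open>v = u\<close> by (simp add: list_eq_iff_nth_eq)
qed

text \<open>Each level is the quotient by \<open>m\<close> minus the number of ascents up to that
  entry. The value of \<open>hd b\<close> is tracked because it bounds the other levels from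
  below.\<close>

lemma lift_stair_surj:
  assumes "sorted L" "0 < m"
  shows "\<exists>b. sorted b \<and> length b = length L \<and> L = lift_stair m (map (\<lambda>a. a mod m) L) b
    \<and> (L \<noteq> [] \<longrightarrow> hd b = hd L div m)"
  using assms
proof (induction L)
  case (Cons a L)
  let ?v = "map (\<lambda>a. a mod m) L"
  obtain b where b: "sorted b" "length b = length L" "L = lift_stair m ?v b"
    "L \<noteq> [] \<longrightarrow> hd b = hd L div m"
    using Cons by auto
  define e :: nat where "e = (if rises (a mod m) ?v then 1 else 0)"
  define b' where "b' = (a div m) # map (\<lambda>c. c - e) b"
  \<comment> \<open>If the residue drops while the entry does not, the quotient must grow, so
    \<open>e\<close> can be subtracted from every level of the tail.\<close>
  have ge: "a div m + e \<le> c" if "c \<in> set b" for c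
  proof -
    have "L \<noteq> []" using that b(2) by auto
    then have "a \<le> hd L" using Cons.prems by (cases L) auto
    have "a div m + e \<le> hd L div m"
    proof (cases "hd L mod m < a mod m")
      case True
      have "a div m < hd L div m"
      proof (rule ccontr)
        assume "\<not> a div m < hd L div m"
        then have "hd L div m * m \<le> a div m * m" by simp
        then show False using True \<open>a \<le> hd L\<close> div_mult_mod_eq[of a m] div_mult_mod_eq[of "hd L" m]
          by linarith
      qed
      then show ?thesis by (simp add: e_def)
    next
      case False
      then show ?thesis using \<open>a \<le> hd L\<close> \<open>L \<noteq> []\<close> by (simp add: e_def hd_map div_le_mono)
    qed
    also have "\<dots> \<le> c" using b(1,4) \<open>L \<noteq> []\<close> that by (cases b) auto
    finally show ?thesis .
  qed
  have "sorted (map (\<lambda>c. c - e) b)"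
    using b(1) by (auto simp: sorted_iff_nth_mono diff_le_mono)
  then have "sorted b'" using ge unfolding b'_def by fastforce
  moreover have "a # L = lift_stair m (map (\<lambda>a. a mod m) (a # L)) b'"
  proof -
    \<comment> \<open>Trades \<open>e\<close> units of level for a shift of the stair by
      \<open>m * e\<close>.\<close>
    have eq: "lift_stair m ?v b = map2 (\<lambda>a c. a + m * c) (map (\<lambda>a. a + m * e) (stair m ?v)) (map (\<lambda>c. c - e) b)"
    proof (rule nth_equalityI)
      fix i assume "i < length (lift_stair m ?v b)"
      then have i: "i < length b" "i < length L" using b(2) by auto
      then have "e \<le> b ! i" using ge[of "b ! i"] by auto
      then have "m * (b ! i) = m * e + m * (b ! i - e)"
        by (metis add_mult_distrib2 le_add_diff_inverse)
      then show "lift_stair m ?v b ! i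
        = map2 (\<lambda>a c. a + m * c) (map (\<lambda>a. a + m * e) (stair m ?v)) (map (\<lambda>c. c - e) b) ! i"
        using i by (simp add: lift_stair_def)
    qed (use b in simp)
    have me: "m * e = (if rises (a mod m) ?v then m else 0)" by (simp add: e_def)
    have "L = map2 (\<lambda>a c. a + m * c)
        (map (\<lambda>c. c + (if rises (a mod m) ?v then m else 0)) (stair m ?v)) (map (\<lambda>c. c - e) b)"
      by (rule trans[OF b(3) eq[unfolded me]])
    moreover have "a = a mod m + m * (a div m)" by simp
    ultimately show ?thesis unfolding b'_def lift_stair_def by simp
  qed
  moreover have "length b' = length (a # L)" "hd b' = hd (a # L) div m" by (simp_all add: b'_def b(2))
  ultimately show ?case by blast
qed (simp add: lift_stair_def)

text \<open>No entry is divisible by \<open>m\<close> exactly when the residue word has no zeros;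
  \<open>levels\<close> parametrises the remaining free sorted list by zero counts.\<close>

lemma bij_betw_lift_stair:
  assumes "0 < m"
  shows "bij_betw (\<lambda>(v, ks). lift_stair m v (levels v ks)) (codes m) {L. sorted L \<and> (\<forall>a\<in>set L. \<not> m dvd a)}"
  unfolding bij_betw_def
proof
  have sub: "set v \<subseteq> {..<m}" if "set v \<subseteq> {1..<m}" for v using that by auto
  show "inj_on (\<lambda>(v, ks). lift_stair m v (levels v ks)) (codes m)"
  proof (rule inj_onI, clarify, goal_cases)
    case (1 v ks u ls)
    then have "v = u \<and> levels v ks = levels u ls"
      using sub by (intro lift_stair_inj[OF assms]) (auto simp: codes_def)
    then show ?case using 1 levels_inj[of ks v ls] by (auto simp: codes_def)
  qed
  show "(\<lambda>(v, ks). lift_stair m v (levels v ks)) ` codes m = {L. sorted L \<and> (\<forall>a\<in>set L. \<not> m dvd a)}"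
  proof safe
    fix v ks assume vk: "(v, ks) \<in> codes m"
    then have v: "set v \<subseteq> {..<m}" "length ks = length v" "0 \<notin> set v" using sub by (auto simp: codes_def)
    then show "sorted (lift_stair m v (levels v ks))" by (intro sorted_lift_stair sorted_levels) auto
    show False if "a \<in> set (lift_stair m v (levels v ks))" "m dvd a" for a
    proof -
      have "a mod m \<in> set (map (\<lambda>a. a mod m) (lift_stair m v (levels v ks)))"
        unfolding set_map using that(1) by (rule imageI)
      then have "a mod m \<in> set v" using map_mod_lift_stair v by simp
      then show False using v(3) that(2) by simp
    qed
  next
    fix L :: "nat list" assume L: "sorted L" "\<forall>a\<in>set L. \<not> m dvd a"
    let ?v = "map (\<lambda>a. a mod m) L"
    obtain b where b: "sorted b" "length b = length L" "L = lift_stair m ?v b"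
      using lift_stair_surj[OF L(1) assms] by blast
    obtain ks where "length ks = length ?v" "levels ?v ks = b"
      using levels_surj[of b ?v] b by auto
    moreover have "set ?v \<subseteq> {1..<m}" using L(2) assms by (auto simp: Suc_le_eq mod_greater_zero_iff_not_dvd)
    ultimately have "(?v, ks) \<in> codes m" "L = lift_stair m ?v (levels ?v ks)"
      using b by (auto simp: codes_def)
    then show "L \<in> (\<lambda>(v, ks). lift_stair m v (levels v ks)) ` codes m" by (intro image_eqI[of _ _ "(?v, ks)"]) auto
  qed
qed

section \<open>Partitions as lists\<close>

definition parts_fun :: "nat list \<Rightarrow> nat \<Rightarrow> nat" where
  "parts_fun L t = (if t < length L then rev L ! t else 0)"

text \<open>The conjugate of the partition with parts \<open>L\<close>, indexed from 0.\<close>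

definition conj_fun :: "nat list \<Rightarrow> nat \<Rightarrow> nat" where
  "conj_fun L t = length (filter (\<lambda>a. t < a) L)"

lemma conj_fun_Nil [simp]: "conj_fun [] t = 0"
  by (simp add: conj_fun_def)

lemma conj_fun_Cons: "conj_fun (a # L) t = (if t < a then 1 else 0) + conj_fun L t"
  by (simp add: conj_fun_def)

text \<open>As \<open>p\<close> is nonincreasing, the set is an initial segment of the indices. This
  is the symmetry of the Young diagram under conjugation; \<open>j = 0\<close> counts the nonzero
  parts.\<close>

lemma partition_superlevel:
  assumes "is_partition p"
  shows "i < card {t. j < p t} \<longleftrightarrow> j < p i"
proof -
  have fin: "finite {t. j < p t}"
    by (rule finite_subset[of _ "{t. p t \<noteq> 0}"]) (use assms in \<open>auto simp: is_partition_def\<close>)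
  have down: "p t \<le> p s" if "s \<le> t" for s t
    using assms that by (auto simp: is_partition_def antimono_def)
  show ?thesis
  proof
    assume "j < p i"
    then have "{..i} \<subseteq> {t. j < p t}" using down[of _ i] by (auto intro: less_le_trans)
    then have "card {..i} \<le> card {t. j < p t}" by (intro card_mono fin)
    then show "i < card {t. j < p t}" by simp
  next
    assume i: "i < card {t. j < p t}"
    show "j < p i"
    proof (rule ccontr)
      assume "\<not> j < p i"
      then have "t < i" if "j < p t" for t using down[of i t] that by linarith
      then have "{t. j < p t} \<subseteq> {..<i}" by auto
      then have "card {t. j < p t} \<le> card {..<i}" by (intro card_mono) auto
      then show False using i by simp
    qed
  qed
qed

lemma is_partition_parts_fun:
  assumes "sorted L"
  shows "is_partition (parts_fun L)"
  unfolding is_partition_def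
proof
  have "rev L ! j \<le> rev L ! i" if "i \<le> j" "j < length L" for i j
    using assms that by (intro sorted_rev_nth_mono) auto
  then show "antimono (parts_fun L)"
    by (auto simp: antimono_def parts_fun_def)
  show "finite {i. parts_fun L i \<noteq> 0}"
    by (rule finite_subset[of _ "{..<length L}"]) (auto simp: parts_fun_def)
qed

lemma parts_fun_pos_iff:
  assumes "0 \<notin> set L"
  shows "0 < parts_fun L t \<longleftrightarrow> t < length L"
proof -
  have "rev L ! t \<in> set L" if "t < length L"
    using nth_mem[of t "rev L"] that by simp
  then show ?thesis using assms by (cases "rev L ! t = 0") (auto simp: parts_fun_def)
qed

lemma bij_betw_parts_fun:
  "bij_betw parts_fun {L. sorted L \<and> 0 \<notin> set L} {p. is_partition p}"
  unfolding bij_betw_def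
proof
  show "inj_on parts_fun {L. sorted L \<and> 0 \<notin> set L}"
  proof (rule inj_onI, clarify)
    fix L L' assume L: "0 \<notin> set L" "0 \<notin> set L'" "parts_fun L = parts_fun L'"
    then have "t < length L \<longleftrightarrow> t < length L'" for t
      using parts_fun_pos_iff by metis
    then have len: "length L = length L'" by (metis linorder_neqE_nat less_irrefl)
    have "rev L ! t = rev L' ! t" if "t < length L" for t
      using fun_cong[OF L(3), of t] that len by (simp add: parts_fun_def)
    then have "rev L = rev L'" using len by (intro nth_equalityI) auto
    then show "L = L'" by simp
  qed
  show "parts_fun ` {L. sorted L \<and> 0 \<notin> set L} = {p. is_partition p}"
  proof safe
    fix p assume p: "is_partition p"
    define n where "n = card {t. 0 < p t}"
    have n: "i < n \<longleftrightarrow> 0 < p i" for i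
      unfolding n_def by (rule partition_superlevel[OF p])
    define L where "L = rev (map p [0..<n])"
    have "sorted_wrt (\<ge>) (map p [0..<n])"
      using p by (auto simp: is_partition_def antimono_def sorted_wrt_iff_nth_less)
    then have "sorted L" unfolding L_def sorted_wrt_rev by simp
    moreover have "0 \<notin> set L" using n by (fastforce simp: L_def)
    moreover have "p = parts_fun L"
    proof
      fix t show "p t = parts_fun L t"
        using n[of t] by (auto simp: parts_fun_def L_def)
    qed
    ultimately show "p \<in> parts_fun ` {L. sorted L \<and> 0 \<notin> set L}" by auto
  qed (rule is_partition_parts_fun)
qed

section \<open>Conjugation of partitions\<close>

lemma conj_fun_Suc: "conj_fun L t = conj_fun L (Suc t) + count_list L (Suc t)"
  by (induction L) (auto simp: conj_fun_Cons)

lemma is_partition_conj_fun: "is_partition (conj_fun L)"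
  unfolding is_partition_def
proof
  have "conj_fun L y \<le> conj_fun L x" if "x \<le> y" for x y
    using that by (induction L) (auto simp: conj_fun_Cons)
  then show "antimono (conj_fun L)" by (auto simp: antimono_def)
  have "conj_fun L t = 0" if "sum_list L \<le> t" for t
    using that by (induction L) (auto simp: conj_fun_Cons)
  then have "{i. conj_fun L i \<noteq> 0} \<subseteq> {..<sum_list L}"
    using not_less by blast
  then show "finite {i. conj_fun L i \<noteq> 0}"
    using finite_subset by blast
qed

lemma bij_betw_conj_fun:
  "bij_betw conj_fun {L. sorted L \<and> 0 \<notin> set L} {p. is_partition p}"
  unfolding bij_betw_def
proof
  show "inj_on conj_fun {L. sorted L \<and> 0 \<notin> set L}"
  proof (rule inj_onI, clarify)
    fix L L' :: "nat list"
    assume L: "sorted L" "sorted L'" "0 \<notin> set L" "0 \<notin> set L'" "conj_fun L = conj_fun L'"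
    \<comment> \<open>Consecutive differences of the conjugate are the multiplicities of the
      positive entries.\<close>
    have "count_list L x = count_list L' x" for x
    proof (cases x)
      case 0
      then show ?thesis using L by (simp add: count_notin)
    next
      case (Suc t)
      then show ?thesis using conj_fun_Suc[of L t] conj_fun_Suc[of L' t] L(5) by simp
    qed
    then have "mset L = mset L'" by (intro multiset_eqI) (simp add: count_mset)
    then show "L = L'" using L properties_for_sort by metis
  qed
  show "conj_fun ` {L. sorted L \<and> 0 \<notin> set L} = {p. is_partition p}"
  proof safe
    fix p assume p: "is_partition p"
    define c where "c j = card {t. j < p t}" for j
    have c: "i < c j \<longleftrightarrow> j < p i" for i j
      unfolding c_def by (rule partition_superlevel[OF p])
    \<comment> \<open>The nonzero conjugate parts; \<open>c j\<close> is positive exactly for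
      \<open>j < p 0\<close>.\<close>
    define L where "L = rev (map c [0..<p 0])"
    have "c j \<le> c i" if "i \<le> j" for i j
      using c[of "c i" i] c[of "c i" j] that by linarith
    then have "sorted_wrt (\<ge>) (map c [0..<p 0])"
      by (auto simp: sorted_wrt_iff_nth_less)
    then have "sorted L" unfolding L_def sorted_wrt_rev by simp
    moreover have "0 \<notin> set L"
    proof
      assume "0 \<in> set L"
      then obtain j where "j < p 0" "0 = c j" by (auto simp: L_def)
      then show False using c[of 0 j] by simp
    qed
    moreover have "p = conj_fun L"
    proof
      fix t
      have "p t \<le> p 0" using p by (auto simp: is_partition_def antimono_def)
      have "conj_fun L t = length (filter (\<lambda>a. t < a) (map c [0..<p 0]))"
        unfolding conj_fun_def L_def by (metis length_rev rev_filter)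
      also have "\<dots> = length (filter (\<lambda>j. j < p t) [0..<p 0])"
        by (simp add: filter_map o_def c)
      also have "\<dots> = card {j. j < p 0 \<and> j < p t}"
        by (auto simp: length_filter_conv_card intro: arg_cong[of _ _ card])
      also have "\<dots> = p t"
      proof -
        have "{j. j < p 0 \<and> j < p t} = {..<p t}" using \<open>p t \<le> p 0\<close> by auto
        then show ?thesis by simp
      qed
      finally show "p t = conj_fun L t" by simp
    qed
    ultimately show "p \<in> conj_fun ` {L. sorted L \<and> 0 \<notin> set L}" by auto
  qed (rule is_partition_conj_fun)
qed

section \<open>Size and statistics of partitions given by lists\<close>

lemma psize_parts_fun: "psize (parts_fun L) = sum_list L"
proof -
  have "psize (parts_fun L) = (\<Sum>t<length L. parts_fun L t)"
    unfolding psize_def by (rule Sum_any.expand_superset) (auto simp: parts_fun_def)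
  also have "\<dots> = (\<Sum>t<length L. rev L ! t)" by (simp add: parts_fun_def)
  also have "\<dots> = sum_list (rev L)" by (simp add: sum_list_sum_nth atLeast0LessThan)
  finally show ?thesis by simp
qed

lemma psize_conj_fun: "psize (conj_fun L) = sum_list L"
proof (induction L)
  case Nil
  have "conj_fun [] = (\<lambda>t. 0)" by auto
  then show ?case by (simp add: psize_def)
next
  case (Cons a L)
  have fin: "finite {t. (if t < a then 1 else 0 :: nat) \<noteq> 0}" by simp
  have "psize (conj_fun (a # L)) = Sum_any (\<lambda>t. (if t < a then 1 else 0) + conj_fun L t)"
    by (simp add: psize_def conj_fun_Cons[abs_def])
  also have "\<dots> = Sum_any (\<lambda>t. if t < a then 1 else 0) + psize (conj_fun L)"
    unfolding psize_def
    by (rule Sum_any.distrib[OF fin]) (use is_partition_conj_fun in \<open>auto simp: is_partition_def\<close>)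
  also have "Sum_any (\<lambda>t. if t < a then 1 else 0) = (\<Sum>t<a. 1::nat)"
    by (subst Sum_any.expand_superset[of "{..<a}"]) auto
  finally show ?case using Cons by simp
qed

text \<open>The difference at position \<open>k * m + i\<close> is the multiplicity of that number
  in \<open>L\<close>, so the sum over \<open>k\<close> counts a residue class. For
  \<open>i = m\<close> this is class 0, whose members in \<open>L\<close> are at least
  \<open>m\<close> because 0 is excluded.\<close>

lemma s_stat_conj_fun:
  assumes "1 \<le> i" "i \<le> m" "0 \<notin> set L"
  shows "s_stat m i (conj_fun L) = count_list (map (\<lambda>a. a mod m) L) (i mod m)"
proof -
  have "nth_part (conj_fun L) (k * m + i) - nth_part (conj_fun L) (k * m + i + 1)
      = count_list L (k * m + i)" for k
  proof -
    obtain j where "k * m + i = Suc j" using assms(1) by (cases "k * m + i") auto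
    moreover have "conj_fun L j - conj_fun L (Suc j) = count_list L (Suc j)"
      using conj_fun_Suc[of L j] by linarith
    ultimately show ?thesis by (simp add: nth_part_def)
  qed
  then have "s_stat m i (conj_fun L) = Sum_any (\<lambda>k. count_list L (k * m + i))"
    by (simp add: s_stat_def)
  also have "\<dots> = count_list (map (\<lambda>a. a mod m) L) (i mod m)"
    using assms(3)
  proof (induction L)
    case (Cons a L)
    \<comment> \<open>\<open>Sum_any\<close> splits additively only for finite supports, so the
      contributing \<open>k\<close> are bounded.\<close>
    have "k \<le> sum_list L" if "count_list L (k * m + i) \<noteq> 0" for k
    proof -
      have "k * m + i \<in> set L" using that by (metis count_notin)
      then have "k * m + i \<le> sum_list L" by (rule member_le_sum_list) simp
      moreover have "k * 1 \<le> k * m" using assms by (intro mult_le_mono2) auto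
      ultimately show ?thesis by linarith
    qed
    then have "{k. count_list L (k * m + i) \<noteq> 0} \<subseteq> {..sum_list L}" by blast
    then have fin: "finite {k. count_list L (k * m + i) \<noteq> 0}"
      using finite_subset by blast
    have "k = (a - i) div m" if "k * m + i = a" for k
      using that assms by auto
    then have sub: "{k. (if k * m + i = a then 1 else 0 :: nat) \<noteq> 0} \<subseteq> {(a - i) div m}"
      by (auto split: if_splits)
    have "Sum_any (\<lambda>k. count_list (a # L) (k * m + i))
        = Sum_any (\<lambda>k. (if k * m + i = a then 1 else 0) + count_list L (k * m + i))"
      by (intro Sum_any.cong) auto
    also have "\<dots> = Sum_any (\<lambda>k. if k * m + i = a then 1 else 0) + Sum_any (\<lambda>k. count_list L (k * m + i))"
      by (rule Sum_any.distrib[OF finite_subset[OF sub] fin]) simp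
    also have "Sum_any (\<lambda>k. if k * m + i = a then 1 else 0 :: nat) = (if a mod m = i mod m then 1 else 0)"
    proof (cases "a mod m = i mod m")
      case True
      have "i \<le> a"
      proof (cases "i = m")
        case True
        then have "m dvd a" using \<open>a mod m = i mod m\<close> by (simp add: mod_eq_0_iff_dvd)
        then show ?thesis using True Cons.prems by (auto intro: dvd_imp_le)
      next
        case False
        then show ?thesis using \<open>a mod m = i mod m\<close> assms by (metis le_neq_implies_less mod_less mod_less_eq_dividend)
      qed
      then have "m dvd a - i" using True by (simp add: mod_eq_dvd_iff_nat)
      then obtain k0 where k0: "a = k0 * m + i" using \<open>i \<le> a\<close>
        by (metis dvd_div_mult_self le_add_diff_inverse2)
      have "Sum_any (\<lambda>k. if k * m + i = a then 1 else 0 :: nat) = Sum_any (\<lambda>k. if k = k0 then 1 else 0 :: nat)"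
        using k0 assms by (intro Sum_any.cong) auto
      then show ?thesis using True by simp
    next
      case False
      then have "k * m + i \<noteq> a" for k by auto
      then have "Sum_any (\<lambda>k. if k * m + i = a then 1 else 0 :: nat) = Sum_any (\<lambda>k::nat. 0)"
        by (intro Sum_any.cong) simp
      then show ?thesis using False by simp
    qed
    finally show ?case using Cons by auto
  qed simp
  finally show ?thesis .
qed

text \<open>Passes from positions counted from 1 to indices of the sequence counted from 0.\<close>

lemma Suc_card_shift: "card {j. 1 \<le> j \<and> P (j - 1)} = card {t. P t}" for P :: "nat \<Rightarrow> bool"
proof -
  have "{j. 1 \<le> j \<and> P (j - 1)} = Suc ` {t. P t}"
    by (auto simp: image_iff) (metis One_nat_def Suc_pred less_eq_Suc_le)
  then show ?thesis by (simp add: card_image)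
qed

lemma l_stat_parts_fun:
  assumes "0 \<notin> set L"
  shows "l_stat m i (parts_fun L) = count_list (map (\<lambda>a. a mod m) L) (i mod m)"
proof -
  have "l_stat m i (parts_fun L) = card {t. 0 < parts_fun L t \<and> parts_fun L t mod m = i mod m}"
    unfolding l_stat_def nth_part_def cong_def
    by (rule Suc_card_shift[of "\<lambda>t. 0 < parts_fun L t \<and> parts_fun L t mod m = i mod m"])
  also have "\<dots> = card {t. t < length (rev L) \<and> rev L ! t mod m = i mod m}"
    using parts_fun_pos_iff[OF assms] by (auto simp: parts_fun_def intro!: arg_cong[of _ _ card])
  also have "\<dots> = length (filter (\<lambda>a. a mod m = i mod m) (rev L))"
    by (simp add: length_filter_conv_card)
  also have "\<dots> = count_list (map (\<lambda>a. a mod m) L) (i mod m)"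
    by (induction L) (auto)
  finally show ?thesis .
qed

lemma num_parts_parts_fun:
  assumes "0 \<notin> set L"
  shows "num_parts (parts_fun L) = length L"
proof -
  have "num_parts (parts_fun L) = card {t. 0 < parts_fun L t}"
    unfolding num_parts_def nth_part_def by (rule Suc_card_shift)
  then show ?thesis by (simp add: parts_fun_pos_iff[OF assms])
qed

lemma nth_part_parts_fun_1: "nth_part (parts_fun L) 1 = (if L = [] then 0 else last L)"
  by (simp add: nth_part_def parts_fun_def rev_nth last_conv_nth)

section \<open>The sets \<open>D_parts m\<close> and \<open>O_parts m\<close> in terms of
  lists\<close>

lemma D_parts_eq: "D_parts m = {p. is_partition p \<and> (\<forall>k>0. card {t. p t = k} \<le> m - 1)}"
proof -
  have "card {j. 1 \<le> j \<and> p (j - 1) = k} = card {t. p t = k}" for p :: "nat \<Rightarrow> nat" and k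
    by (rule Suc_card_shift)
  then show ?thesis by (simp only: D_parts_def nth_part_def)
qed

lemma bij_betw_parts_fun_O:
  assumes "0 < m"
  shows "bij_betw parts_fun {L. sorted L \<and> (\<forall>a\<in>set L. \<not> m dvd a)} (O_parts m)"
proof -
  have O: "O_parts m = {p. is_partition p \<and> (\<forall>t. 0 < p t \<longrightarrow> \<not> m dvd p t)}"
  proof -
    have "(\<forall>j\<ge>1. P (j - 1)) \<longleftrightarrow> (\<forall>t. P t)" for P :: "nat \<Rightarrow> bool"
    proof (intro iffI allI impI)
      fix t assume "\<forall>j\<ge>1. P (j - 1)"
      then have "P (Suc t - 1)" by (simp only: le_add1 Suc_eq_plus1 le_add2)
      then show "P t" by simp
    qed blast
    then show ?thesis
      unfolding O_parts_def nth_part_def by (intro Collect_cong conj_cong refl)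
  qed
  have "(\<forall>a\<in>set L. \<not> m dvd a) \<longleftrightarrow> (\<forall>t. 0 < parts_fun L t \<longrightarrow> \<not> m dvd parts_fun L t)"
    if "0 \<notin> set L" for L
  proof -
    have "(\<forall>t. 0 < parts_fun L t \<longrightarrow> \<not> m dvd parts_fun L t) \<longleftrightarrow> (\<forall>t<length L. \<not> m dvd rev L ! t)"
      unfolding parts_fun_pos_iff[OF that] by (simp add: parts_fun_def)
    also have "\<dots> \<longleftrightarrow> (\<forall>a\<in>set (rev L). \<not> m dvd a)"
      unfolding all_set_conv_all_nth by simp
    finally show ?thesis by simp
  qed
  then have "bij_betw parts_fun {L \<in> {L. sorted L \<and> 0 \<notin> set L}. \<forall>a\<in>set L. \<not> m dvd a}
      {p \<in> {p. is_partition p}. \<forall>t. 0 < p t \<longrightarrow> \<not> m dvd p t}"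
    by (intro bij_betw_Collect[OF bij_betw_parts_fun]) blast
  \<comment> \<open>As \<open>m\<close> divides 0, nondivisibility already excludes zero
    entries.\<close>
  moreover have "{L \<in> {L. sorted L \<and> 0 \<notin> set L}. \<forall>a\<in>set L. \<not> m dvd a} = {L. sorted L \<and> (\<forall>a\<in>set L. \<not> m dvd a)}"
    using dvd_0_right[of m] by fast
  ultimately show ?thesis by (simp only: O mem_Collect_eq)
qed

lemma finite_partitions_psize_le: "finite {p. is_partition p \<and> psize p \<le> n}"
proof -
  have "{p. is_partition p \<and> psize p \<le> n} \<subseteq> parts_fun ` {L. set L \<subseteq> {..n} \<and> length L \<le> n}"
  proof safe
    fix p assume p: "is_partition p" "psize p \<le> n"
    then obtain L where L: "p = parts_fun L" "0 \<notin> set L"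
      using bij_betw_imp_surj_on[OF bij_betw_parts_fun] by blast
    then have s: "sum_list L \<le> n" using p by (simp add: psize_parts_fun)
    have "length L \<le> sum_list L" using L(2)
      by (induction L) auto
    moreover have "a \<le> sum_list L" if "a \<in> set L" for a using that by (rule member_le_sum_list) simp
    ultimately show "p \<in> parts_fun ` {L. set L \<subseteq> {..n} \<and> length L \<le> n}"
      using L(1) s by (intro image_eqI[of _ _ L]) (auto intro: order_trans)
  qed
  then show ?thesis by (rule finite_subset) (intro finite_imageI finite_lists_length_le finite_atMost)
qed

text \<open>From \<open>p\<close> on, the conjugate of \<open>a # L\<close> takes its top value
  \<open>Suc (length L)\<close> exactly on \<open>{p..<a}\<close> and then agrees with that of
  \<open>L\<close>. Multiplicities in the conjugate are thus the gaps between consecutive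
  entries.\<close>

lemma flat_iff_card:
  assumes "sorted (p # L)" "0 < m"
  shows "flat m p L \<longleftrightarrow> (\<forall>k>0. card {t. p \<le> t \<and> conj_fun L t = k} \<le> m - 1)"
  using assms(1)
proof (induction L arbitrary: p)
  case Nil
  have "{t. p \<le> t \<and> conj_fun [] t = k} = {}" if "0 < k" for k
    using that by simp
  then show ?case by simp
next
  case (Cons a L)
  have "sorted (a # L)" "p \<le> a" using Cons.prems by auto
  have len: "conj_fun L t \<le> length L" for t
    by (simp add: conj_fun_def)
  have below: "conj_fun (a # L) t = Suc (length L)" if "t < a" for t
  proof -
    have "\<forall>x\<in>set L. t < x" using that \<open>sorted (a # L)\<close> by fastforce
    then have "filter (\<lambda>x. t < x) L = L" by (rule filter_True)
    then show ?thesis using that by (simp add: conj_fun_def)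
  qed
  have above: "conj_fun (a # L) t = conj_fun L t" "conj_fun L t \<noteq> Suc (length L)" if "a \<le> t" for t
    using that len[of t] by (auto simp: conj_fun_Cons)
  have top: "{t. p \<le> t \<and> conj_fun (a # L) t = Suc (length L)} = {p..<a}"
  proof (rule set_eqI)
    fix t show "t \<in> {t. p \<le> t \<and> conj_fun (a # L) t = Suc (length L)} \<longleftrightarrow> t \<in> {p..<a}"
      using below[of t] above[of t] by (cases "t < a") simp_all
  qed
  have rest: "{t. p \<le> t \<and> conj_fun (a # L) t = k} = {t. a \<le> t \<and> conj_fun L t = k}"
    if "k \<noteq> Suc (length L)" for k
  proof (rule set_eqI)
    fix t show "t \<in> {t. p \<le> t \<and> conj_fun (a # L) t = k} \<longleftrightarrow> t \<in> {t. a \<le> t \<and> conj_fun L t = k}"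
      using below[of t] above[of t] that \<open>p \<le> a\<close> by (cases "t < a") auto
  qed
  have none: "{t. a \<le> t \<and> conj_fun L t = Suc (length L)} = {}"
    using above(2) by blast
  have "(\<forall>k>0. card {t. p \<le> t \<and> conj_fun (a # L) t = k} \<le> m - 1)
    \<longleftrightarrow> a - p \<le> m - 1 \<and> (\<forall>k>0. card {t. a \<le> t \<and> conj_fun L t = k} \<le> m - 1)"
    (is "?l \<longleftrightarrow> ?r")
  proof
    assume l: ?l
    then have "card {p..<a} \<le> m - 1" using top by (metis zero_less_Suc)
    moreover have "card {t. a \<le> t \<and> conj_fun L t = k} \<le> m - 1" if "0 < k" for k
    proof (cases "k = Suc (length L)")
      case True
      then show ?thesis unfolding True none by simp
    next
      case False
      then show ?thesis using l that unfolding rest[OF False, symmetric] by blast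
    qed
    ultimately show ?r by simp
  next
    assume r: ?r
    have "card {t. p \<le> t \<and> conj_fun (a # L) t = k} \<le> m - 1" if "0 < k" for k
    proof (cases "k = Suc (length L)")
      case True
      then show ?thesis using r unfolding True top by simp
    next
      case False
      then show ?thesis using r that unfolding rest[OF False] by blast
    qed
    then show ?l by blast
  qed
  moreover have "a - p \<le> m - 1 \<longleftrightarrow> a < p + m" using \<open>0 < m\<close> by linarith
  ultimately show ?case using Cons.IH[OF \<open>sorted (a # L)\<close>] \<open>p \<le> a\<close> by simp
qed

lemma bij_betw_conj_fun_D:
  assumes "0 < m"
  shows "bij_betw conj_fun {L. flat m 0 L \<and> 0 \<notin> set L} (D_parts m)"
proof -
  have flat: "flat m 0 L \<longleftrightarrow> (\<forall>k>0. card {t. conj_fun L t = k} \<le> m - 1)" if "sorted L" for L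
    using flat_iff_card[of 0 L m] that assms by simp
  then have "bij_betw conj_fun {L \<in> {L. sorted L \<and> 0 \<notin> set L}. flat m 0 L}
      {p \<in> {p. is_partition p}. \<forall>k>0. card {t. p t = k} \<le> m - 1}"
    by (intro bij_betw_Collect[OF bij_betw_conj_fun]) blast
  moreover have "sorted L" if "flat m 0 L" for L
    using flat_sorted[OF that] by simp
  then have "{L \<in> {L. sorted L \<and> 0 \<notin> set L}. flat m 0 L} = {L. flat m 0 L \<and> 0 \<notin> set L}"
    by blast
  ultimately show ?thesis by (simp only: D_parts_eq mem_Collect_eq)
qed

text \<open>The head of \<open>w\<close> is the last letter of \<open>rev w\<close>, so prepending
  \<open>x\<close> can only add an ascent at index \<open>length w - 1\<close>.\<close>

lemma card_ascents_rev:
  "card {t. Suc t < length w \<and> rev w ! t < rev w ! Suc t} = num_rises w"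
proof (induction w)
  case (Cons x w)
  have "{t. Suc t < length (x # w) \<and> rev (x # w) ! t < rev (x # w) ! Suc t}
    = {t. Suc t < length w \<and> rev w ! t < rev w ! Suc t} \<union> (if rises x w then {length w - 1} else {})"
    (is "?A = ?B \<union> ?C")
  proof (intro set_eqI)
    fix t
    consider "Suc t < length w" | "Suc t = length w" | "Suc t > length w" by linarith
    then show "t \<in> ?A \<longleftrightarrow> t \<in> ?B \<union> ?C"
    proof cases
      case 1
      then have "rev (x # w) ! t = rev w ! t" "rev (x # w) ! Suc t = rev w ! Suc t" "t \<noteq> length w - 1"
        by (auto simp: nth_append)
      then show ?thesis using 1 by simp
    next
      case 2
      then have "w \<noteq> []" "length w - Suc t = 0" by auto
      then have "rev w ! t = hd w" using 2 by (simp add: rev_nth hd_conv_nth)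
      moreover have "t = length w - 1" "t < length (rev w)" "Suc t = length (rev w)" using 2 by simp_all
      ultimately have "rev (x # w) ! t = hd w" "rev (x # w) ! Suc t = x" "t = length w - 1"
        by (simp_all add: nth_append)
      then show ?thesis using 2 \<open>w \<noteq> []\<close> by simp
    next
      case 3
      then have "\<not> Suc t < length (x # w)" "\<not> Suc t < length w" "w = [] \<or> t \<noteq> length w - 1" by auto
      then show ?thesis by auto
    qed
  qed
  moreover have "finite ?B" by (rule finite_subset[of _ "{..<length w}"]) auto
  moreover have "length w - 1 \<notin> ?B" by auto
  ultimately show ?case using Cons.IH by (cases "rises x w") simp_all
qed simp

lemma asc_parts_fun:
  assumes "0 \<notin> set L"
  shows "asc m (parts_fun L) = num_rises (map (\<lambda>a. a mod m) L)"
proof -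
  let ?w = "map (\<lambda>a. a mod m) L"
  have "asc m (parts_fun L) = card {j. 1 \<le> j \<and> Suc (j - 1) < length L \<and>
      parts_fun L (j - 1) mod m < parts_fun L (Suc (j - 1)) mod m}"
    unfolding asc_def num_parts_parts_fun[OF assms] nth_part_def
    by (intro arg_cong[of _ _ card] Collect_cong) auto
  also have "\<dots> = card {t. Suc t < length L \<and> parts_fun L t mod m < parts_fun L (Suc t) mod m}"
    by (rule Suc_card_shift)
  also have "\<dots> = card {t. Suc t < length ?w \<and> rev ?w ! t < rev ?w ! Suc t}"
    by (intro arg_cong[of _ _ card] Collect_cong) (auto simp: parts_fun_def rev_map)
  finally show ?thesis by (simp only: card_ascents_rev)
qed

section \<open>Comparison of the two series\<close>

lemma count_list_replicate_zero: "count_list (replicate k (0::nat)) i = (if i = 0 then k else 0)"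
  by (induction k) auto

lemma count_list_insert_zeros:
  assumes "length ks = length v" "0 \<notin> set v"
  shows "count_list (insert_zeros v ks) i = (if i = 0 then sum_list ks else count_list v i)"
  using assms
proof (induction v arbitrary: ks)
  case (Cons x v)
  then obtain k ks' where ks: "ks = k # ks'" "length ks' = length v" by (cases ks) auto
  then show ?case using Cons.IH[of ks'] Cons.prems by (auto simp: count_list_replicate_zero)
qed simp

lemma sum_list_insert_zeros: "length ks = length v \<Longrightarrow> sum_list (insert_zeros v ks) = sum_list v"
proof (induction v arbitrary: ks)
  case (Cons x v)
  then obtain k ks' where ks: "ks = k # ks'" "length ks' = length v" by (cases ks) auto
  then show ?case using Cons.IH[of ks'] by (simp add: sum_list_replicate)
qed simp

text \<open>The stair contributes one unit of quotient per ascent and the lift adds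
  \<open>last b\<close>, so subtracting the ascents leaves \<open>last b\<close> as the exponent of
  \<open>zvar m\<close>.\<close>

lemma last_lift_stair_div:
  assumes "set v \<subseteq> {..<m}" "length b = length v" "v \<noteq> []"
  shows "last (lift_stair m v b) div m = num_rises v + last b"
proof -
  have "length (zip (stair m v) b) = length v" using assms by simp
  then have b: "b \<noteq> []" "zip (stair m v) b \<noteq> []"
    using assms(2,3) by (metis length_0_conv)+
  have "0 < m" using assms(1,3) by (cases v) auto
  have "last (lift_stair m v b) = last (stair m v) + m * last b"
    unfolding lift_stair_def last_map[OF b(2)] using assms b by (simp add: last_zip)
  then show ?thesis using last_stair_div[OF assms(1,3)] \<open>0 < m\<close> by simp
qed

text \<open>The term at \<open>x\<close> has no coefficient below degree \<open>d x\<close>, so each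
  coefficient of the sum involves only finitely many terms.\<close>

lemma summable_on_fps_X_power:
  fixes c :: "'a \<Rightarrow> 'b :: comm_ring_1 fps"
  assumes "\<And>n. finite {x \<in> A. d x \<le> n}"
  shows "(\<lambda>x. c x * fps_X ^ d x) summable_on A"
proof -
  let ?F = "\<lambda>x. c x * fps_X ^ d x"
  have "finite {x \<in> A. fps_nth (?F x) n \<noteq> 0}" for n
    by (rule finite_subset[OF _ assms[of n]]) (auto simp: fps_X_power_mult_right_nth)
  then have "(?F has_sum Abs_fps (\<lambda>n. \<Sum>x | x \<in> A \<and> fps_nth (?F x) n \<noteq> 0. fps_nth (?F x) n)) A"
    by (rule has_sum_fpsI) simp
  then show ?thesis by (rule has_sum_imp_summable)
qed

theorem theorem1p4:
  fixes m :: nat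
  assumes "m \<ge> 2"
  shows "(\<lambda>\<mu>. (\<Prod>i=1..m-1. zvar i ^ s_stat m i \<mu>) * zvar m ^ s_stat m m \<mu> * qvar ^ psize \<mu>)
           summable_on D_parts m
       \<and> (\<lambda>\<nu>. (\<Prod>i=1..m-1. zvar i ^ l_stat m i \<nu>) * zvar m ^ (nth_part \<nu> 1 div m - asc m \<nu>) * qvar ^ psize \<nu>)
           summable_on O_parts m
       \<and> (\<Sum>\<^sub>\<infinity>\<mu>\<in>D_parts m. (\<Prod>i=1..m-1. zvar i ^ s_stat m i \<mu>) * zvar m ^ s_stat m m \<mu> * qvar ^ psize \<mu>)
       = (\<Sum>\<^sub>\<infinity>\<nu>\<in>O_parts m. (\<Prod>i=1..m-1. zvar i ^ l_stat m i \<nu>) * zvar m ^ (nth_part \<nu> 1 div m - asc m \<nu>) * qvar ^ psize \<nu>)"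
proof -
  have m: "0 < m" using assms by simp
  define f where "f \<mu> = (\<Prod>i=1..m-1. zvar i ^ s_stat m i \<mu>) * zvar m ^ s_stat m m \<mu> * qvar ^ psize \<mu>" for \<mu>
  define g where "g \<nu> = (\<Prod>i=1..m-1. zvar i ^ l_stat m i \<nu>) * zvar m ^ (nth_part \<nu> 1 div m - asc m \<nu>) * qvar ^ psize \<nu>" for \<nu>
  \<comment> \<open>\<open>D\<close> inserts the zeros into the residue word and conjugates;
    \<open>R\<close> converts the same zero counts into levels.\<close>
  define D where "D = conj_fun \<circ> (stair m \<circ> (\<lambda>(v, ks). insert_zeros v ks))"
  define R where "R = parts_fun \<circ> (\<lambda>(v, ks). lift_stair m v (levels v ks))"
  have D: "bij_betw D (codes m) (D_parts m)"
    unfolding D_def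
    by (intro bij_betw_trans[OF bij_betw_trans[OF bij_betw_insert_zeros bij_betw_stair[OF m]]]
        bij_betw_conj_fun_D m)
  have R: "bij_betw R (codes m) (O_parts m)"
    unfolding R_def by (rule bij_betw_trans[OF bij_betw_lift_stair[OF m] bij_betw_parts_fun_O[OF m]])
  have eq: "f (D c) = g (R c)" if "c \<in> codes m" for c
  proof -
    obtain v ks where c: "c = (v, ks)" by (cases c)
    define w where "w = insert_zeros v ks"
    define L where "L = lift_stair m v (levels v ks)"
    have v: "length ks = length v" "0 \<notin> set v" "set v \<subseteq> {..<m}"
      using that by (auto simp: c codes_def)
    have "w \<in> {w. set w \<subseteq> {..<m} \<and> (w = [] \<or> hd w \<noteq> 0)}"
      using bij_betwE[OF bij_betw_insert_zeros] that unfolding c w_def by fastforce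
    then have w: "set w \<subseteq> {..<m}" "0 \<notin> set (stair m w)"
      using bij_betwE[OF bij_betw_stair[OF m]] by auto
    have DR: "D c = conj_fun (stair m w)" "R c = parts_fun L"
      by (simp_all add: D_def R_def w_def L_def c)
    have "L \<in> {L. sorted L \<and> (\<forall>a\<in>set L. \<not> m dvd a)}"
      using bij_betwE[OF bij_betw_lift_stair[OF m]] that unfolding c L_def by fastforce
    then have L0: "0 \<notin> set L" by auto
    have Lmod: "map (\<lambda>a. a mod m) L = v"
      unfolding L_def by (rule map_mod_lift_stair) (use v in simp_all)
    have s: "s_stat m i (D c) = count_list w (i mod m)" if "1 \<le> i" "i \<le> m" for i
      using s_stat_conj_fun[OF that w(2)] by (simp add: DR map_mod_stair[OF w(1)])
    \<comment> \<open>Inserted zeros do not change the number of letters \<open>i\<close> with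
      \<open>0 < i < m\<close>.\<close>
    have "s_stat m i (D c) = l_stat m i (R c)" if "i \<in> {1..m-1}" for i
    proof -
      have "1 \<le> i" "i < m" using that m by auto
      then show ?thesis
        using s[of i] l_stat_parts_fun[OF L0, of m i] count_list_insert_zeros[OF v(1,2), of i]
        by (simp add: DR(2) Lmod w_def)
    qed
    \<comment> \<open>Both exponents are the number of inserted zeros, which is the largest level.
      The empty word is treated apart, having no largest level.\<close>
    moreover have "s_stat m m (D c) = nth_part (R c) 1 div m - asc m (R c)"
    proof (cases "v = []")
      case True
      then show ?thesis using s[of m] m by (simp add: DR w_def L_def lift_stair_def
            nth_part_parts_fun_1[unfolded One_nat_def])
    next
      case False
      then have "L \<noteq> []" using Lmod by auto
      have "last L div m = num_rises v + sum_list ks"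
        unfolding L_def using last_lift_stair_div[OF v(3) _ False, of "levels v ks"]
        by (simp add: last_levels[OF v(1) False])
      then have "nth_part (R c) 1 div m - asc m (R c) = sum_list ks"
        using \<open>L \<noteq> []\<close> by (simp only: DR nth_part_parts_fun_1 asc_parts_fun[OF L0] Lmod if_False)
      moreover have "s_stat m m (D c) = sum_list ks"
        using s[of m] m count_list_insert_zeros[OF v(1,2), of 0] by (simp add: w_def)
      ultimately show ?thesis by simp
    qed
    \<comment> \<open>Both sizes are
      \<open>sum_list v + m * (maj v + sum_list (levels v ks))\<close>.\<close>
    moreover have "psize (D c) = psize (R c)"
      by (simp add: DR psize_conj_fun psize_parts_fun sum_list_stair w_def L_def sum_list_lift_stair
          sum_list_insert_zeros[OF v(1)] maj_insert_zeros[OF v(1,2)])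
    ultimately show ?thesis unfolding f_def g_def by simp
  qed
  \<comment> \<open>Finiteness in each size gives summability over \<open>O_parts m\<close>; the
    bijections carry it over to \<open>D_parts m\<close>.\<close>
  have "finite {\<nu> \<in> O_parts m. psize \<nu> \<le> n}" for n
    by (rule finite_subset[OF _ finite_partitions_psize_le[of n]]) (auto simp: O_parts_def)
  then have sg: "g summable_on O_parts m"
    unfolding g_def qvar_def by (rule summable_on_fps_X_power)
  then have "(\<lambda>c. g (R c)) summable_on codes m"
    by (simp only: summable_on_reindex_bij_betw[OF R])
  then have "(\<lambda>c. f (D c)) summable_on codes m"
    using eq by (simp cong: summable_on_cong)
  then have sf: "f summable_on D_parts m"
    by (simp only: summable_on_reindex_bij_betw[OF D])
  have "infsum f (D_parts m) = infsum (\<lambda>c. f (D c)) (codes m)"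
    by (rule infsum_reindex_bij_betw[OF D, symmetric])
  also have "\<dots> = infsum (\<lambda>c. g (R c)) (codes m)"
    by (rule infsum_cong) (rule eq)
  also have "\<dots> = infsum g (O_parts m)"
    by (rule infsum_reindex_bij_betw[OF R])
  finally show ?thesis using sf sg unfolding f_def g_def by simp
qed

end
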